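(* Let $\lambda_0\in\Lambda$ with induced optimal partition $\bar\pi(\lambda_0)$, let $\bar\tau$ be the associated index function, and let $\bar l=|\bar B(\lambda_0)|$. Let $\lambda\in\Lambda$, $\lambda\ne\lambda_0$, be such that Conditions 1–3 stated in the context (for the partition $\bar\pi(\lambda_0)$) hold at $\lambda$. Then the optimal value function has the representation $$Z(\lambda)=\frac{1}{\lambda-\lambda_0}\left(\prod_{j=1}^{\bar l}\frac{1+(\lambda-\lambda_0)\alpha_j^{\times}}{1+(\lambda-\lambda_0)\alpha_j}-1\right),$$ where the nonzero values among $\alpha_1^\times,\dots,\alpha_{\bar l}^\times$ are the nonzero eigenvalues (with multiplicity) of $(\mathbf{\triangle A}_{\bar\tau}+\mathbf{b}\mathbf{c}_{\bar\tau}^T)\mathbf{A}^\dagger_{\bar\tau}(\lambda_0)$ and the nonzero values among $\alpha_1,\dots,\alpha_{\bar l}$ are the nonzero eigenvalues (with multiplicity) of $\mathbf{\triangle A}_{\bar\tau}\mathbf{A}^\dagger_{\bar\tau}(\lambda_0)$, and $1+(\lambda-\lambda_0)\alpha_j\ne0$ for all $j$ is assumed.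
   Context: Data: $A,\triangle A\in\mathbb{R}^{m\times n}$, $b,\triangle b\in\mathbb{R}^m$, $c\in\mathbb{R}^n$. For $\lambda\in\mathbb{R}$ consider $P(\triangle A,\triangle b)$: $\min\{c^Tx : (A+\lambda\triangle A)x=b+\lambda\triangle b,\ x\ge0\}$ and its dual $D(\triangle A,\triangle b)$: $\max\{(b+\lambda\triangle b)^Ty : (A+\lambda\triangle A)^Ty+s=c,\ s\ge0\}$. $\Lambda\subseteq\mathbb{R}$ is the set of $\lambda$ for which $P(\triangle A,\triangle b)$ has an optimal solution. Standing assumptions: both problems are feasible at $\lambda=0$, and $\Lambda$ is an interval. Put $z=\triangle A\,x-\triangle b$. The equivalent problem is $P_\lambda(\mathbf{\triangle A})$: $\min\{\mathbf{c}^T\mathbf{x} : (\mathbf{A}+\lambda\mathbf{\triangle A})\mathbf{x}=\mathbf{b},\ \mathbf{x}=(x,z)^T,\ x\ge0\}$ ($z\in\mathbb{R}^m$ free), with $\mathbf{c}=\begin{pmatrix}c\\0\end{pmatrix}$, $\mathbf{A}=\begin{pmatrix}A&0\\ \triangle A&-I_m\end{pmatrix}$, $\mathbf{\triangle A}=\begin{pmatrix}0&I_m\\0&0\end{pmatrix}$, $\mathbf{b}=\begin{pmatrix}b\\ \triangle b\end{pmatrix}$; $Z(\lambda)$ denotes its optimal value. Its dual is $D_\lambda(\mathbf{\triangle A})$: $\max\{b^Ty+\triangle b^Tw : A^Ty+\triangle A^Tw+s=c,\ \lambda y-w=0,\ s\ge0\}$. Write $\mathbf{y}=(y,w)$ and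 $\mathbf{s}=(s,0)\in\mathbb{R}^{n+m}$. Let $\mathcal{P}^*_\lambda$, $\mathcal{D}^*_\lambda$ be the optimal solution sets of $P_\lambda(\mathbf{\triangle A})$, $D_\lambda(\mathbf{\triangle A})$. Induced optimal partition at $\lambda$: $\bar\pi(\lambda)=(\bar B(\lambda),\bar N(\lambda))$, $\bar B=B\cup B^-\cup B^+$, $\bar N=N\cup N^0$, where $B(\lambda)=\{j\le n: \mathbf{x}_j>0\text{ for some }\mathbf{x}\in\mathcal{P}^*_\lambda\}$, $B^-(\lambda)=\{n+1\le j\le n+m:\mathbf{x}_j<0\text{ for some }\mathbf{x}\in\mathcal{P}^*_\lambda\}$, $B^+(\lambda)=\{n+1\le j\le n+m:\mathbf{x}_j>0\text{ for some }\mathbf{x}\in\mathcal{P}^*_\lambda\}$, $N(\lambda)=\{j\le n:\mathbf{s}_j>0\text{ for some }(\mathbf{y},\mathbf{s})\in\mathcal{D}^*_\lambda\}$, $N^0(\lambda)=\{n+1\le j\le n+m:\mathbf{x}_j=0\text{ for all }\mathbf{x}\in\mathcal{P}^*_\lambda\}$. An induced optimal solution $(\mathbf{x}^*,\mathbf{y}^*,\mathbf{s}^* )$ is an optimal primal-dual solution of $P_\lambda(\mathbf{\triangle A})$, $D_\lambda(\mathbf{\triangle A})$ arising from an optimal solution of $P(\triangle A,\triangle b)$, $D(\triangle A,\triangle b)$. $\bar\tau:\{1,\dots,\bar l\}\to\{1,\dots,n+m\}$ is the strictly increasing enumeration of $\bar B(\lambda_0)$; $\tau$, $\tau'$ are those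 of $B(\lambda_0)$ and $N(\lambda_0)=\{1,\dots,n\}\setminus B(\lambda_0)$. Such a subscript on a matrix (vector) selects the corresponding columns (components). $\mathbf{A}_{\bar\tau}(\lambda)=(\mathbf{A}+\lambda\mathbf{\triangle A})_{\bar\tau}$, $A_\tau(\lambda)=(A+\lambda\triangle A)_\tau$, $A_{\tau'}(\lambda)=(A+\lambda\triangle A)_{\tau'}$. $M^\dagger$ is the Moore–Penrose inverse (pseudo-inverse) of $M$; $e_q$ is the $q$-th unit vector. Conditions 1–3 at $\lambda$ (they are the conditions characterizing that an induced strictly complementary optimal solution $(\mathbf{x}^*(\lambda),\mathbf{y}^*(\lambda),\mathbf{s}^*(\lambda))$ of $P_\lambda(\mathbf{\triangle A})$, $D_\lambda(\mathbf{\triangle A})$ exists with this partition): (1) $\mathbf{A}_{\bar\tau}(\lambda)$ has a pseudo-inverse; (2) for $1\le q\le\bar l$, $(\mathbf{x}^*_{\bar\tau}(\lambda))_q=e_q^T\mathbf{A}^\dagger_{\bar\tau}(\lambda)\mathbf{b}$ is positive when $\bar\tau(q)\in B(\lambda_0)\cup B^+(\lambda_0)$ and negative when $\bar\tau(q)\in B^-(\lambda_0)$, all other components of the optimal solution $\mathbf{x}^*(\lambda)$ being zero; (3) $s^*_{\tau'}(\lambda)=c_{\tau'}^T-c_\tau^TA_\tau^\dagger(\lambda)A_{\tau'}(\lambda)>0$, all other components of $\mathbf{s}^*(\lambda)$ being zero. Convention: $\mathbf{A}_{\bar\tau}(\lambda_0)$ (of size $2m\times\bar l$) has full rank, i.e.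 $\mathbf{A}_{\bar\tau}(\lambda_0)\mathbf{A}^\dagger_{\bar\tau}(\lambda_0)=I_{2m}$ if $2m\le\bar l$ and $\mathbf{A}^\dagger_{\bar\tau}(\lambda_0)\mathbf{A}_{\bar\tau}(\lambda_0)=I_{\bar l}$ if $2m\ge\bar l$. Those $\alpha_j,\alpha_j^\times$ not accounted for by nonzero eigenvalues are zero. *)

theory Defs
  imports
    "HOL-Library.Multiset"
    "Jordan_Normal_Form.Char_Poly"
    "Jordan_Normal_Form.DL_Submatrix"
begin

(* Throughout, m = dim_row A, n = dim_col A, and t is the real perturbation parameter.
   Components are numbered from 0, so the x-part of a vector in R^(n+m) occupies the
   indices 0..<n and the z-part the indices n..<n+m. *)

definition moore_penrose :: "real mat \<Rightarrow> real mat \<Rightarrow> bool" where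
  "moore_penrose M X \<longleftrightarrow>
     X \<in> carrier_mat (dim_col M) (dim_row M) \<and>
     M * X * M = M \<and> X * M * X = X \<and>
     transpose_mat (M * X) = M * X \<and> transpose_mat (X * M) = X * M"

definition pinv :: "real mat \<Rightarrow> real mat" where
  "pinv M = (THE X. moore_penrose M X)"

(* pick J is the strictly increasing enumeration of J, starting at argument 0. *)
definition sel_cols :: "'a mat \<Rightarrow> nat set \<Rightarrow> 'a mat" where
  "sel_cols M J = submatrix M UNIV J"

definition sel_vec :: "'a vec \<Rightarrow> nat set \<Rightarrow> 'a vec" where
  "sel_vec v J = vec (card {j. j < dim_vec v \<and> j \<in> J}) (\<lambda>q. v $ pick J q)"

definition pert :: "real mat \<Rightarrow> real mat \<Rightarrow> real \<Rightarrow> real mat" where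
  "pert M dM t = M + t \<cdot>\<^sub>m dM"

subsection \<open>The parametric problem and its dual\<close>

definition P_feasible :: "real mat \<Rightarrow> real mat \<Rightarrow> real vec \<Rightarrow> real vec \<Rightarrow> real \<Rightarrow> real vec set" where
  "P_feasible A dA b db t =
     {x \<in> carrier_vec (dim_col A). pert A dA t *\<^sub>v x = b + t \<cdot>\<^sub>v db \<and> 0\<^sub>v (dim_col A) \<le> x}"

definition P_optimal ::
  "real mat \<Rightarrow> real mat \<Rightarrow> real vec \<Rightarrow> real vec \<Rightarrow> real vec \<Rightarrow> real \<Rightarrow> real vec set" where
  "P_optimal A dA b db c t = {x. is_arg_min (\<lambda>x. c \<bullet> x) (\<lambda>x. x \<in> P_feasible A dA b db t) x}"

definition D_feasible :: "real mat \<Rightarrow> real mat \<Rightarrow> real vec \<Rightarrow> real \<Rightarrow> (real vec \<times> real vec) set" where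
  "D_feasible A dA c t =
     {(y, s). y \<in> carrier_vec (dim_row A) \<and> s \<in> carrier_vec (dim_col A) \<and>
              transpose_mat (pert A dA t) *\<^sub>v y + s = c \<and> 0\<^sub>v (dim_col A) \<le> s}"

definition D_optimal ::
  "real mat \<Rightarrow> real mat \<Rightarrow> real vec \<Rightarrow> real vec \<Rightarrow> real vec \<Rightarrow> real \<Rightarrow> (real vec \<times> real vec) set" where
  "D_optimal A dA b db c t =
     {p. is_arg_max (\<lambda>(y, s). (b + t \<cdot>\<^sub>v db) \<bullet> y) (\<lambda>p. p \<in> D_feasible A dA c t) p}"

definition Lam :: "real mat \<Rightarrow> real mat \<Rightarrow> real vec \<Rightarrow> real vec \<Rightarrow> real vec \<Rightarrow> real set" where
  "Lam A dA b db c = {t. P_optimal A dA b db c t \<noteq> {}}"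

subsection \<open>The equivalent problem with perturbed matrix only\<close>

definition blkA :: "real mat \<Rightarrow> real mat \<Rightarrow> real mat" where
  "blkA A dA = four_block_mat A (0\<^sub>m (dim_row A) (dim_row A)) dA (- 1\<^sub>m (dim_row A))"

definition blk_dA :: "real mat \<Rightarrow> real mat" where
  "blk_dA A = four_block_mat (0\<^sub>m (dim_row A) (dim_col A)) (1\<^sub>m (dim_row A))
                             (0\<^sub>m (dim_row A) (dim_col A)) (0\<^sub>m (dim_row A) (dim_row A))"

definition blk_b :: "real vec \<Rightarrow> real vec \<Rightarrow> real vec" where
  "blk_b b db = b @\<^sub>v db"

definition blk_c :: "real mat \<Rightarrow> real vec \<Rightarrow> real vec" where
  "blk_c A c = c @\<^sub>v 0\<^sub>v (dim_row A)"

definition P'_feasible :: "real mat \<Rightarrow> real mat \<Rightarrow> real vec \<Rightarrow> real vec \<Rightarrow> real \<Rightarrow> real vec set" where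
  "P'_feasible A dA b db t =
     {xz. \<exists>x z. xz = x @\<^sub>v z \<and> x \<in> carrier_vec (dim_col A) \<and> z \<in> carrier_vec (dim_row A) \<and>
                pert (blkA A dA) (blk_dA A) t *\<^sub>v xz = blk_b b db \<and> 0\<^sub>v (dim_col A) \<le> x}"

definition P'_optimal ::
  "real mat \<Rightarrow> real mat \<Rightarrow> real vec \<Rightarrow> real vec \<Rightarrow> real vec \<Rightarrow> real \<Rightarrow> real vec set" where
  "P'_optimal A dA b db c t =
     {x. is_arg_min (\<lambda>x. blk_c A c \<bullet> x) (\<lambda>x. x \<in> P'_feasible A dA b db t) x}"

(* Dual points are stored as ((y, w), (s, 0)) in R^(2m) x R^(n+m). *)
definition D'_feasible :: "real mat \<Rightarrow> real mat \<Rightarrow> real vec \<Rightarrow> real \<Rightarrow> (real vec \<times> real vec) set" where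
  "D'_feasible A dA c t =
     {(y @\<^sub>v w, s @\<^sub>v 0\<^sub>v (dim_row A)) | y w s.
        y \<in> carrier_vec (dim_row A) \<and> w \<in> carrier_vec (dim_row A) \<and> s \<in> carrier_vec (dim_col A) \<and>
        transpose_mat A *\<^sub>v y + transpose_mat dA *\<^sub>v w + s = c \<and>
        t \<cdot>\<^sub>v y - w = 0\<^sub>v (dim_row A) \<and> 0\<^sub>v (dim_col A) \<le> s}"

definition D'_optimal ::
  "real mat \<Rightarrow> real mat \<Rightarrow> real vec \<Rightarrow> real vec \<Rightarrow> real vec \<Rightarrow> real \<Rightarrow> (real vec \<times> real vec) set" where
  "D'_optimal A dA b db c t =
     {p. is_arg_max (\<lambda>(y, s). blk_b b db \<bullet> y) (\<lambda>p. p \<in> D'_feasible A dA c t) p}"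

(* Only meaningful when the infimum exists, in particular for t in Lam. *)
definition Z :: "real mat \<Rightarrow> real mat \<Rightarrow> real vec \<Rightarrow> real vec \<Rightarrow> real vec \<Rightarrow> real \<Rightarrow> real" where
  "Z A dA b db c t = Inf ((\<lambda>x. blk_c A c \<bullet> x) ` P'_feasible A dA b db t)"

definition induced_optimal ::
  "real mat \<Rightarrow> real mat \<Rightarrow> real vec \<Rightarrow> real vec \<Rightarrow> real vec \<Rightarrow> real
     \<Rightarrow> real vec \<Rightarrow> real vec \<Rightarrow> real vec \<Rightarrow> bool" where
  "induced_optimal A dA b db c t x y s \<longleftrightarrow>
     x \<in> P'_optimal A dA b db c t \<and> (y, s) \<in> D'_optimal A dA b db c t \<and>
     (\<exists>x0 \<in> P_optimal A dA b db c t. x = x0 @\<^sub>v (dA *\<^sub>v x0 - db)) \<and>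
     (\<exists>(y0, s0) \<in> D_optimal A dA b db c t. y = y0 @\<^sub>v (t \<cdot>\<^sub>v y0) \<and> s = s0 @\<^sub>v 0\<^sub>v (dim_row A))"

subsection \<open>Induced optimal partition\<close>

definition part_B :: "real mat \<Rightarrow> real mat \<Rightarrow> real vec \<Rightarrow> real vec \<Rightarrow> real vec \<Rightarrow> real \<Rightarrow> nat set" where
  "part_B A dA b db c t = {j. j < dim_col A \<and> (\<exists>x \<in> P'_optimal A dA b db c t. x $ j > 0)}"

definition part_Bminus :: "real mat \<Rightarrow> real mat \<Rightarrow> real vec \<Rightarrow> real vec \<Rightarrow> real vec \<Rightarrow> real \<Rightarrow> nat set" where
  "part_Bminus A dA b db c t =
     {j. dim_col A \<le> j \<and> j < dim_col A + dim_row A \<and> (\<exists>x \<in> P'_optimal A dA b db c t. x $ j < 0)}"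

definition part_Bplus :: "real mat \<Rightarrow> real mat \<Rightarrow> real vec \<Rightarrow> real vec \<Rightarrow> real vec \<Rightarrow> real \<Rightarrow> nat set" where
  "part_Bplus A dA b db c t =
     {j. dim_col A \<le> j \<and> j < dim_col A + dim_row A \<and> (\<exists>x \<in> P'_optimal A dA b db c t. x $ j > 0)}"

definition part_N :: "real mat \<Rightarrow> real mat \<Rightarrow> real vec \<Rightarrow> real vec \<Rightarrow> real vec \<Rightarrow> real \<Rightarrow> nat set" where
  "part_N A dA b db c t = {j. j < dim_col A \<and> (\<exists>(y, s) \<in> D'_optimal A dA b db c t. s $ j > 0)}"

definition part_N0 :: "real mat \<Rightarrow> real mat \<Rightarrow> real vec \<Rightarrow> real vec \<Rightarrow> real vec \<Rightarrow> real \<Rightarrow> nat set" where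
  "part_N0 A dA b db c t =
     {j. dim_col A \<le> j \<and> j < dim_col A + dim_row A \<and> (\<forall>x \<in> P'_optimal A dA b db c t. x $ j = 0)}"

definition induced_partition ::
  "real mat \<Rightarrow> real mat \<Rightarrow> real vec \<Rightarrow> real vec \<Rightarrow> real vec \<Rightarrow> real \<Rightarrow> nat set \<times> nat set" where
  "induced_partition A dA b db c t =
     (part_B A dA b db c t \<union> part_Bminus A dA b db c t \<union> part_Bplus A dA b db c t,
      part_N A dA b db c t \<union> part_N0 A dA b db c t)"

(* In the following, J is the first component of the induced partition at t0. *)

definition A_bar :: "real mat \<Rightarrow> real mat \<Rightarrow> nat set \<Rightarrow> real \<Rightarrow> real mat" where
  "A_bar A dA J t = sel_cols (pert (blkA A dA) (blk_dA A) t) J"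

definition condition1 :: "real mat \<Rightarrow> real mat \<Rightarrow> nat set \<Rightarrow> real \<Rightarrow> bool" where
  "condition1 A dA J t \<longleftrightarrow> (\<exists>X. moore_penrose (A_bar A dA J t) X)"

definition condition2 ::
  "real mat \<Rightarrow> real mat \<Rightarrow> real vec \<Rightarrow> real vec \<Rightarrow> real vec \<Rightarrow> real \<Rightarrow> nat set \<Rightarrow> real \<Rightarrow> real vec \<Rightarrow> bool"
where
  "condition2 A dA b db c t0 J t x \<longleftrightarrow>
     (\<forall>q < card J.
        sel_vec x J $ q = unit_vec (card J) q \<bullet> (pinv (A_bar A dA J t) *\<^sub>v blk_b b db) \<and>
        (pick J q \<in> part_B A dA b db c t0 \<union> part_Bplus A dA b db c t0 \<longrightarrow> sel_vec x J $ q > 0) \<and>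
        (pick J q \<in> part_Bminus A dA b db c t0 \<longrightarrow> sel_vec x J $ q < 0)) \<and>
     (\<forall>j < dim_col A + dim_row A. j \<notin> J \<longrightarrow> x $ j = 0)"

(* The nonbasic columns are those of {0..<n} - B(t0); this is N(t0) by strict complementarity. *)
definition condition3 ::
  "real mat \<Rightarrow> real mat \<Rightarrow> real vec \<Rightarrow> real vec \<Rightarrow> real vec \<Rightarrow> real \<Rightarrow> real \<Rightarrow> real vec \<Rightarrow> bool" where
  "condition3 A dA b db c t0 t s \<longleftrightarrow>
     (let B = part_B A dA b db c t0; N = {..<dim_col A} - B;
          A\<tau> = sel_cols (pert A dA t) B; A\<tau>' = sel_cols (pert A dA t) N
      in sel_vec s N = sel_vec c N - transpose_mat (pinv A\<tau> * A\<tau>') *\<^sub>v sel_vec c B \<and>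
         (\<forall>q < card N. sel_vec s N $ q > 0) \<and>
         (\<forall>j < dim_col A + dim_row A. j \<notin> N \<longrightarrow> s $ j = 0))"

(* The nonzero values among a 1, ..., a l, counted with repetition, are the nonzero complex
   eigenvalues of M, counted with algebraic multiplicity. *)
definition nonzero_eigenvalue_list :: "nat \<Rightarrow> (nat \<Rightarrow> complex) \<Rightarrow> real mat \<Rightarrow> bool" where
  "nonzero_eigenvalue_list l a M \<longleftrightarrow>
     filter_mset (\<lambda>z. z \<noteq> 0) (image_mset a (mset_set {1..l})) =
     filter_mset (\<lambda>z. z \<noteq> 0) (proots (char_poly (map_mat complex_of_real M)))"

end

theory Submission
  imports Defs
begin

text \<open>
  Write \<open>d = t - t0\<close>, let \<open>M0\<close> and \<open>M = M0 + d D\<close> be the basic columns at \<open>t0\<close> and \<open>t\<close>, and let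
  \<open>X\<close> be the pseudo-inverse of \<open>M0\<close>. Primal feasibility reads \<open>M x = b\<close> and complementary slackness
  gives a dual solution with \<open>M\<^sup>T y = c\<close>. The two products are \<open>det (1 + d D X)\<close> and
  \<open>det (1 + d (D + b c\<^sup>T) X)\<close>. If \<open>M0 X = 1\<close>, these matrices are \<open>M X\<close> and \<open>(1 + d b y\<^sup>T) M X\<close>;
  if \<open>X M0 = 1\<close>, swapping the factors inside the determinants turns them into \<open>X M\<close> and
  \<open>X M (1 + d x c\<^sup>T)\<close>. In both cases the quotient of the determinants is \<open>1 + d c\<^sup>T x\<close>, and
  \<open>c\<^sup>T x\<close> is the optimal value.
\<close>

subsection \<open>Existence and uniqueness of the Moore--Penrose inverse\<close>

text \<open>Here and in the next three lemmas the premises are equations between dimensions. Unlike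
  \<open>carrier_mat\<close> premises they bring in no variables beyond the matrices themselves, so
  the laws work as rewrite rules.\<close>

lemma mult_assoc_dim:
  "dim_col A = dim_row B \<Longrightarrow> dim_col B = dim_row C \<Longrightarrow> A * B * C = A * (B * (C :: 'a :: semiring_0 mat))"
  by (intro assoc_mult_mat) auto

lemma transpose_mult_dim:
  "dim_col A = dim_row B \<Longrightarrow>
    transpose_mat (A * B) = transpose_mat B * transpose_mat (A :: 'a :: comm_semiring_0 mat)"
  by (intro transpose_mult) auto

lemma smult_mult_dim:
  "dim_col A = dim_row B \<Longrightarrow> d \<cdot>\<^sub>m A * B = d \<cdot>\<^sub>m (A * (B :: 'a :: comm_semiring_0 mat))"
  by (intro mult_smult_assoc_mat) auto

lemma mult_smult_dim:
  "dim_col A = dim_row B \<Longrightarrow> A * (d \<cdot>\<^sub>m B) = d \<cdot>\<^sub>m (A * (B :: 'a :: comm_semiring_0 mat))"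
  by (intro mult_smult_distrib) auto

lemma index_mult_sum:
  assumes "A \<in> carrier_mat m k" "B \<in> carrier_mat k n" "i < m" "j < n"
  shows "(A * B) $$ (i, j) = (\<Sum>r<k. A $$ (i, r) * B $$ (r, j))"
  using assms by (simp add: scalar_prod_def atLeast0LessThan)

text \<open>Elimination: each round splits off a rank-one part of \<open>A\<close> and leaves fewer
  nonzero columns, which is the induction measure.\<close>

lemma exists_generalized_inverse:
  fixes A :: "'a :: field mat"
  assumes "A \<in> carrier_mat m n"
  shows "\<exists>H \<in> carrier_mat n m. A * H * A = A"
  using assms
proof (induction "card {j. j < n \<and> col A j \<noteq> 0\<^sub>v m}" arbitrary: A rule: less_induct)
  case less
  note A = less.prems
  show ?case
  proof (cases "A = 0\<^sub>m m n")
    case True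
    then show ?thesis by (intro bexI[of _ "0\<^sub>m n m"]) auto
  next
    case False
    then obtain i j where ij: "i < m" "j < n" and a: "A $$ (i, j) \<noteq> 0"
      using A by (metis carrier_matD(1) carrier_matD(2) eq_matI index_zero_mat)
    \<comment> \<open>Subtracting \<open>A e\<^sub>j e\<^sub>i\<^sup>T A / A\<^sub>i\<^sub>j\<close> clears column \<open>j\<close> and keeps zero columns zero.\<close>
    define E where "E = mat n m (\<lambda>(p, q). if p = j \<and> q = i then inverse (A $$ (i, j)) else 0)"
    define A' where "A' = A - A * E * A"
    have E: "E \<in> carrier_mat n m" and A': "A' \<in> carrier_mat m n"
      using A by (auto simp: E_def A'_def)
    have AEA: "(A * E * A) $$ (p, q) = A $$ (p, j) * A $$ (i, q) / A $$ (i, j)"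
      if "p < m" "q < n" for p q
    proof -
      have AE: "(A * E) $$ (p, r) = (if r = i then A $$ (p, j) / A $$ (i, j) else 0)" if "r < m" for r
      proof -
        have "(A * E) $$ (p, r) = (\<Sum>k<n. A $$ (p, k) * E $$ (k, r))"
          using A E \<open>p < m\<close> \<open>r < m\<close> by (intro index_mult_sum) auto
        also have "\<dots> = (\<Sum>k<n. if k = j then (if r = i then A $$ (p, j) / A $$ (i, j) else 0) else 0)"
          using \<open>r < m\<close> by (intro sum.cong) (auto simp: E_def field_simps)
        finally show ?thesis using ij by simp
      qed
      have "(A * E * A) $$ (p, q) = (\<Sum>r<m. (A * E) $$ (p, r) * A $$ (r, q))"
        using A E that by (intro index_mult_sum) auto
      also have "\<dots> = (\<Sum>r<m. if r = i then A $$ (p, j) / A $$ (i, j) * A $$ (i, q) else 0)"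
        using AE by (intro sum.cong) auto
      finally show ?thesis using ij by simp
    qed
    have A'_eq: "A' $$ (p, q) = A $$ (p, q) - A $$ (p, j) * A $$ (i, q) / A $$ (i, j)"
      if "p < m" "q < n" for p q
      using AEA[OF that] A E that by (simp add: A'_def del: index_mult_mat(1))
    have zero_iff: "col M q = 0\<^sub>v m \<longleftrightarrow> (\<forall>p<m. M $$ (p, q) = 0)" if "M \<in> carrier_mat m n" "q < n"
      for M :: "'a mat" and q
      using that by (auto simp: vec_eq_iff)
    have "{q. q < n \<and> col A' q \<noteq> 0\<^sub>v m} \<subset> {q. q < n \<and> col A q \<noteq> 0\<^sub>v m}"
    proof (rule psubsetI)
      show "{q. q < n \<and> col A' q \<noteq> 0\<^sub>v m} \<subseteq> {q. q < n \<and> col A q \<noteq> 0\<^sub>v m}"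
        using ij by (auto simp: zero_iff[OF A] zero_iff[OF A'] A'_eq)
      have "j \<in> {q. q < n \<and> col A q \<noteq> 0\<^sub>v m} - {q. q < n \<and> col A' q \<noteq> 0\<^sub>v m}"
        using ij a by (auto simp: zero_iff[OF A] zero_iff[OF A'] A'_eq)
      then show "{q. q < n \<and> col A' q \<noteq> 0\<^sub>v m} \<noteq> {q. q < n \<and> col A q \<noteq> 0\<^sub>v m}" by blast
    qed
    then have "card {q. q < n \<and> col A' q \<noteq> 0\<^sub>v m} < card {q. q < n \<and> col A q \<noteq> 0\<^sub>v m}"
      by (intro psubset_card_mono) auto
    from less.hyps[OF this A'] obtain H where H: "H \<in> carrier_mat n m" and AHA: "A' * H * A' = A'"
      by blast
    \<comment> \<open>Since \<open>A' = P A = A Q\<close>, a generalized inverse \<open>H\<close> of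
      \<open>A'\<close> gives \<open>A (Q H P) A = A' H A' = A'\<close>; adding \<open>E\<close>
      puts back the removed part \<open>A E A\<close>.\<close>
    define P where "P = 1\<^sub>m m - A * E"
    define Q where "Q = 1\<^sub>m n - E * A"
    have P: "P \<in> carrier_mat m m" and Q: "Q \<in> carrier_mat n n"
      using A E by (auto simp: P_def Q_def)
    have PA: "A' = P * A" and AQ: "A' = A * Q"
      using A E by (simp_all add: P_def Q_def A'_def minus_mult_distrib_mat[of _ m m _ _ n]
        mult_minus_distrib_mat[of _ m n _ n] mult_assoc_dim)
    have "A * (Q * H * P + E) * A = A * Q * H * (P * A) + A * E * A"
      using A E P Q H
      by (simp add: mult_add_distrib_mat[of _ m n _ m] add_mult_distrib_mat[of _ m m _ _ n] mult_assoc_dim)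
    also have "\<dots> = A' + A * E * A"
      using AHA by (simp flip: PA AQ)
    also have "\<dots> = A"
      using A E by (intro eq_matI) (auto simp: A'_def)
    finally show ?thesis
      using Q H P E by (intro bexI[of _ "Q * H * P + E"]) auto
  qed
qed

text \<open>The diagonal entries of \<open>N^T N\<close> are the squared lengths of the columns of
  \<open>N\<close>, and real sums of squares vanish only termwise.\<close>

lemma transpose_mult_self_eq_0:
  fixes N :: "real mat"
  assumes N: "N \<in> carrier_mat m n" and "transpose_mat N * N = 0\<^sub>m n n"
  shows "N = 0\<^sub>m m n"
proof (rule eq_matI)
  fix i j assume ij: "i < dim_row (0\<^sub>m m n)" "j < dim_col (0\<^sub>m m n)"
  then have "(\<Sum>k<m. N $$ (k, j) ^ 2) = (transpose_mat N * N) $$ (j, j)"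
    using N by (simp add: scalar_prod_def atLeast0LessThan power2_eq_square)
  then have "(\<Sum>k<m. N $$ (k, j) ^ 2) = 0"
    using assms ij by simp
  then show "N $$ (i, j) = 0\<^sub>m m n $$ (i, j)"
    using ij by (subst (asm) sum_nonneg_eq_0_iff) auto
qed (use N in auto)

text \<open>The witness is \<open>W = H M^T\<close> with \<open>H\<close> a generalized inverse of
  the Gram matrix \<open>G = M^T M\<close>; then \<open>M W\<close> is the orthogonal projection
  onto the column space. \<open>H\<close> may fail to be symmetric, but \<open>H^T\<close> is again
  a generalized inverse of the symmetric \<open>G\<close>, and comparing the two makes
  \<open>M W\<close> symmetric.\<close>

lemma exists_left_projector:
  fixes M :: "real mat"
  assumes M: "M \<in> carrier_mat m n"
  shows "\<exists>W \<in> carrier_mat n m. M * W * M = M \<and> transpose_mat (M * W) = M * W"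
proof -
  define G where "G = transpose_mat M * M"
  have G: "G \<in> carrier_mat n n" and Gt: "transpose_mat G = G"
    using M by (auto simp: G_def transpose_mult_dim)
  obtain H where H: "H \<in> carrier_mat n n" and GHG: "G * H * G = G"
    using exists_generalized_inverse[OF G] by blast
  \<comment> \<open>\<open>M\<^sup>T (M K G - M) = G K G - G = 0\<close>, and \<open>M\<^sup>T\<close> is injective on the range of \<open>M\<close>.\<close>
  have absorb: "M * K * G = M" if K: "K \<in> carrier_mat n n" and GKG: "G * K * G = G" for K
  proof -
    define N where "N = M * (K * G - 1\<^sub>m n)"
    have N: "N \<in> carrier_mat m n" using M G K by (auto simp: N_def)
    have MN: "transpose_mat M * N = 0\<^sub>m n n"
    proof -
      have "transpose_mat M * N = G * (K * G - 1\<^sub>m n)"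
        using M G K by (simp add: N_def G_def mult_assoc_dim)
      also have "\<dots> = G * K * G - G"
        using G K by (simp add: mult_minus_distrib_mat[of _ n n _ n] mult_assoc_dim)
      finally show ?thesis using GKG G by simp
    qed
    have "transpose_mat N * N = transpose_mat (K * G - 1\<^sub>m n) * (transpose_mat M * N)"
      using M G K N unfolding N_def
      by (subst transpose_mult_dim) (auto intro!: mult_assoc_dim)
    also have "\<dots> = 0\<^sub>m n n"
      unfolding MN using G K by (intro right_mult_zero_mat) auto
    finally have "N = 0\<^sub>m m n"
      using N by (rule transpose_mult_self_eq_0[rotated])
    then have "M * K * G - M = 0\<^sub>m m n"
      using M G K by (simp add: N_def mult_minus_distrib_mat[of _ m n _ n] mult_assoc_dim)
    then show ?thesis
      using M G K by (intro eq_matI) (auto simp: mat_eq_iff)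
  qed
  have Ht: "transpose_mat H \<in> carrier_mat n n" and Mt: "transpose_mat M \<in> carrier_mat n m"
    using H M by auto
  have "transpose_mat (G * H * G) = G * transpose_mat H * G"
    using G H by (simp add: transpose_mult_dim Gt mult_assoc_dim)
  then have "G * transpose_mat H * G = G"
    using GHG Gt by simp
  note 1 = absorb[OF H GHG] and 2 = absorb[OF Ht this]
  have "transpose_mat (M * transpose_mat H * G) = G * H * transpose_mat M"
    using M G H by (simp add: transpose_mult_dim Gt mult_assoc_dim)
  then have 3: "transpose_mat M = G * H * transpose_mat M"
    using 2 by simp
  \<comment> \<open>Expanding \<open>M^T\<close> by \<open>3\<close> and then contracting
    \<open>M H^T G\<close> by \<open>2\<close> replaces \<open>H^T\<close> by
    \<open>H\<close>.\<close>
  have "transpose_mat (M * (H * transpose_mat M)) = M * transpose_mat H * transpose_mat M"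
    using M H by (simp add: transpose_mult_dim mult_assoc_dim)
  also have "\<dots> = M * transpose_mat H * (G * H * transpose_mat M)"
    using 3 by simp
  also have "\<dots> = M * transpose_mat H * G * (H * transpose_mat M)"
    using M G H by (simp add: mult_assoc_dim)
  finally have sym: "transpose_mat (M * (H * transpose_mat M)) = M * (H * transpose_mat M)"
    using 2 by simp
  have "M * (H * transpose_mat M) * M = M"
    using 1 M H by (simp add: G_def mult_assoc_dim)
  with sym show ?thesis
    using M H by (intro bexI[of _ "H * transpose_mat M"]) auto
qed

text \<open>The two symmetry conditions are met separately: \<open>W\<close> makes
  \<open>M W\<close> symmetric, and \<open>V\<close>, obtained from the transposed matrix, makes
  \<open>V M\<close> symmetric. \<open>X = V M W\<close> inherits both, because
  \<open>M X = M W\<close> and \<open>X M = V M\<close>.\<close>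

lemma moore_penrose_exists: "\<exists>X. moore_penrose M X"
proof -
  define m n where "m = dim_row M" and "n = dim_col M"
  have M: "M \<in> carrier_mat m n" by (simp add: m_def n_def)
  obtain W where W: "W \<in> carrier_mat n m" "M * W * M = M" "transpose_mat (M * W) = M * W"
    using exists_left_projector[OF M] by blast
  obtain V' where V': "V' \<in> carrier_mat m n"
    "transpose_mat M * V' * transpose_mat M = transpose_mat M"
    "transpose_mat (transpose_mat M * V') = transpose_mat M * V'"
    using exists_left_projector[of "transpose_mat M" n m] M by auto
  define V where "V = transpose_mat V'"
  have V: "V \<in> carrier_mat n m" using V' by (simp add: V_def)
  have V't: "V' = transpose_mat V" by (simp add: V_def)
  have "transpose_mat (transpose_mat M * V' * transpose_mat M) = M * (V * M)"
    using M V by (simp add: V't transpose_mult_dim)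
  then have MVM: "M * V * M = M"
    using V' M V by (simp add: mult_assoc_dim)
  have VMt: "transpose_mat (V * M) = V * M"
    using V' M V by (simp add: V't transpose_mult_dim)
  define X where "X = V * M * W"
  have X: "X \<in> carrier_mat n m" using V W M by (auto simp: X_def)
  have "M * X = M * V * M * W"
    using V W M by (simp add: X_def mult_assoc_dim)
  then have MX: "M * X = M * W" by (simp add: MVM)
  have "X * M = V * (M * W * M)"
    using V W M by (simp add: X_def mult_assoc_dim)
  then have XM: "X * M = V * M" by (simp add: W)
  have "X * M * X = V * (M * X)"
    using V W X M by (simp add: XM mult_assoc_dim)
  also have "\<dots> = X"
    using V W M by (simp add: MX) (simp add: X_def mult_assoc_dim)
  finally have "moore_penrose M X"
    using X W VMt unfolding moore_penrose_def MX XM by (simp add: m_def n_def)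
  then show ?thesis ..
qed

text \<open>By symmetry \<open>M X = (M Y) (M X) = ((M X) (M Y))^T = (M Y)^T = M Y\<close>, and
  likewise \<open>X M = Y M\<close>; hence \<open>X = X M X = Y M X = Y M Y\<close>.\<close>

lemma moore_penrose_unique:
  assumes "moore_penrose M X" "moore_penrose M Y"
  shows "X = Y"
proof -
  define m n where "m = dim_row M" and "n = dim_col M"
  have M: "M \<in> carrier_mat m n" by (simp add: m_def n_def)
  have X: "X \<in> carrier_mat n m" and Y: "Y \<in> carrier_mat n m"
    using assms by (auto simp: moore_penrose_def m_def n_def)
  have X_eqs: "M * X * M = M" "X * M * X = X" "transpose_mat (M * X) = M * X" "transpose_mat (X * M) = X * M"
    and Y_eqs: "M * Y * M = M" "Y * M * Y = Y" "transpose_mat (M * Y) = M * Y" "transpose_mat (Y * M) = Y * M"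
    using assms by (auto simp: moore_penrose_def)
  have MX: "M * X = M * Y"
  proof -
    have "M * X = M * Y * M * X" by (simp only: Y_eqs)
    also have "\<dots> = transpose_mat (M * Y) * transpose_mat (M * X)"
      using M X Y by (simp add: X_eqs(3) Y_eqs(3) mult_assoc_dim)
    also have "\<dots> = transpose_mat (M * X * (M * Y))"
      using M X Y by (intro transpose_mult[symmetric, of _ m m _ m]) auto
    also have "M * X * (M * Y) = M * X * M * Y"
      using M X Y by (intro assoc_mult_mat[symmetric, of _ m m _ n _ m]) auto
    finally show ?thesis by (simp only: X_eqs Y_eqs)
  qed
  have XM: "X * M = Y * M"
  proof -
    have "X * M = X * (M * Y * M)" by (simp only: Y_eqs)
    also have "\<dots> = transpose_mat (X * M) * transpose_mat (Y * M)"
      using M X Y by (simp add: X_eqs(4) Y_eqs(4) mult_assoc_dim)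
    also have "\<dots> = transpose_mat (Y * M * (X * M))"
      using M X Y by (intro transpose_mult[symmetric, of _ n n _ n]) auto
    also have "Y * M * (X * M) = Y * (M * X * M)"
      using M X Y by (simp add: mult_assoc_dim)
    finally show ?thesis by (simp only: X_eqs Y_eqs)
  qed
  have "X = X * M * X" by (simp only: X_eqs)
  also have "\<dots> = Y * (M * X)" using M X Y by (simp only: XM) (simp add: mult_assoc_dim)
  also have "\<dots> = Y * M * Y" using M X Y by (simp only: MX) (simp add: mult_assoc_dim)
  finally show ?thesis by (simp only: Y_eqs)
qed

lemma moore_penrose_pinv: "moore_penrose M (pinv M)"
  unfolding pinv_def using moore_penrose_exists moore_penrose_unique by (metis theI)

lemma pinv_carrier [simp]: "M \<in> carrier_mat m n \<Longrightarrow> pinv M \<in> carrier_mat n m"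
  using moore_penrose_pinv[of M] unfolding moore_penrose_def by auto

subsection \<open>Eigenvalues of products\<close>

text \<open>The powers of \<open>x\<close> balance the different sizes and avoid division, so
  \<open>x = 0\<close> is no exception. This serves both for characteristic polynomials and, at
  \<open>x = 1\<close>, for determinants.\<close>

lemma det_char_mult_swap:
  fixes x :: "'a :: idom"
  assumes A: "A \<in> carrier_mat k l" and B: "B \<in> carrier_mat l k"
  shows "x ^ l * det (x \<cdot>\<^sub>m 1\<^sub>m k - A * B) = x ^ k * det (x \<cdot>\<^sub>m 1\<^sub>m l - B * A)"
proof -
  \<comment> \<open>Both sides are \<open>x\<^sup>l det T\<close>: eliminate \<open>B\<close> by column operations, resp. by row operations.\<close>
  define T where "T = four_block_mat (x \<cdot>\<^sub>m 1\<^sub>m k) A B (1\<^sub>m l)"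
  define R where "R = four_block_mat (1\<^sub>m k) (0\<^sub>m k l) (- B) (1\<^sub>m l)"
  define L where "L = four_block_mat (1\<^sub>m k) (0\<^sub>m k l) (- B) (x \<cdot>\<^sub>m 1\<^sub>m l)"
  have carr: "T \<in> carrier_mat (k + l) (k + l)" "R \<in> carrier_mat (k + l) (k + l)"
    "L \<in> carrier_mat (k + l) (k + l)"
    using A B by (auto simp: T_def R_def L_def)
  have TR: "T * R = four_block_mat (x \<cdot>\<^sub>m 1\<^sub>m k - A * B) A (0\<^sub>m l k) (1\<^sub>m l)"
    unfolding T_def R_def using A B
    by (subst mult_four_block_mat[of _ k k _ l _ l _ _ k _ l])
       (auto intro!: cong_four_block_mat)
  have LT: "L * T = four_block_mat (x \<cdot>\<^sub>m 1\<^sub>m k) A (0\<^sub>m l k) (x \<cdot>\<^sub>m 1\<^sub>m l - B * A)"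
    unfolding T_def L_def using A B
    by (subst mult_four_block_mat[of _ k k _ l _ l _ _ k _ l])
       (auto intro!: cong_four_block_mat)
  have "det R = 1" "det L = x ^ l"
    using B by (auto simp: R_def L_def det_four_block_mat_upper_right_zero[of _ k _ l])
  moreover have "det (T * R) = det (x \<cdot>\<^sub>m 1\<^sub>m k - A * B)"
    unfolding TR using A B
    by (subst det_four_block_mat_lower_left_zero[of _ k _ l]) auto
  moreover have "det (L * T) = x ^ k * det (x \<cdot>\<^sub>m 1\<^sub>m l - B * A)"
    unfolding LT using A B
    by (subst det_four_block_mat_lower_left_zero[of _ k _ l]) auto
  ultimately show ?thesis
    using carr by (auto simp: det_mult[of _ "k + l"])
qed

lemma poly_char_poly:
  fixes M :: "'a :: field mat"
  assumes "M \<in> carrier_mat k k"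
  shows "poly (char_poly M) x = det (x \<cdot>\<^sub>m 1\<^sub>m k - M)"
proof -
  have "- char_matrix M x = x \<cdot>\<^sub>m 1\<^sub>m k - M"
    using assms by (intro eq_matI) (auto simp: char_matrix_def)
  then show ?thesis using char_poly_matrix[OF assms] by simp
qed

text \<open>The determinant identity holds at every complex point, and polynomials over an infinite
  field are determined by their values.\<close>

lemma char_poly_mult_swap:
  fixes A :: "complex mat"
  assumes A: "A \<in> carrier_mat k l" and B: "B \<in> carrier_mat l k"
  shows "monom 1 l * char_poly (A * B) = monom 1 k * char_poly (B * A)"
proof -
  have "poly (monom 1 l * char_poly (A * B)) x = poly (monom 1 k * char_poly (B * A)) x" for x
    using det_char_mult_swap[OF A B, of x] A B
    by (simp add: poly_monom poly_char_poly[of _ k] poly_char_poly[of _ l])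
  then show ?thesis by (simp add: poly_eq_poly_eq_iff[symmetric] fun_eq_iff)
qed

text \<open>Sylvester's determinant identity. It carries determinants between the sizes
  \<open>k\<close> and \<open>l\<close>: down to size 1 for a rank-one term, and to the size in
  which a left inverse yields the identity.\<close>

lemma det_one_add_mult_swap:
  fixes A :: "'a :: idom mat"
  assumes A: "A \<in> carrier_mat k l" and B: "B \<in> carrier_mat l k"
  shows "det (1\<^sub>m k + A * B) = det (1\<^sub>m l + B * A)"
proof -
  have "1\<^sub>m k + A * B = 1 \<cdot>\<^sub>m 1\<^sub>m k - (- A) * B" "1\<^sub>m l + B * A = 1 \<cdot>\<^sub>m 1\<^sub>m l - B * (- A)"
    using A B by (auto intro!: eq_matI)
  then show ?thesis
    using det_char_mult_swap[of "- A" k l B 1] A B by simp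
qed

text \<open>The matrix determinant lemma: swapping the factors leaves a determinant of size
  1.\<close>

lemma det_one_add_rank_one:
  fixes u v :: "'a :: idom vec"
  assumes u: "u \<in> carrier_vec k" and v: "v \<in> carrier_vec k"
  shows "det (1\<^sub>m k + transpose_mat (mat_of_row u) * mat_of_row v) = 1 + u \<bullet> v"
proof -
  have "1\<^sub>m 1 + mat_of_row v * transpose_mat (mat_of_row u) = mat 1 1 (\<lambda>_. 1 + u \<bullet> v)"
    using u v by (intro eq_matI) (auto simp: comm_scalar_prod[of u k v])
  then show ?thesis
    using u v by (subst det_one_add_mult_swap[of _ k 1]) (auto simp: det_def)
qed

text \<open>The monomials relating the two characteristic polynomials contribute only the root zero,
  which the filter discards.\<close>

lemma char_poly_mult_swap_roots:
  fixes A :: "complex mat"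
  assumes A: "A \<in> carrier_mat k l" and B: "B \<in> carrier_mat l k"
  shows "filter_mset (\<lambda>z. z \<noteq> 0) (proots (char_poly (A * B))) =
         filter_mset (\<lambda>z. z \<noteq> 0) (proots (char_poly (B * A)))"
proof -
  have nz: "char_poly (A * B) \<noteq> 0" "char_poly (B * A) \<noteq> 0"
    using degree_monic_char_poly[of "A * B" k] degree_monic_char_poly[of "B * A" l] A B by auto
  have monom: "filter_mset (\<lambda>z. z \<noteq> 0) (proots (monom 1 n :: complex poly)) = {#}" for n
    by (simp add: poly_monom)
  show ?thesis
    using arg_cong[OF char_poly_mult_swap[OF A B], of "\<lambda>p. filter_mset (\<lambda>z. z \<noteq> 0) (proots p)"]
    using nz by (simp add: proots_mult monom)
qed

section \<open>Eigenvalue lists and their products\<close>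

text \<open>\<open>A * B\<close> has \<open>k\<close> eigenvalues, possibly more than
  \<open>l\<close>, but its nonzero ones are those of the \<open>l\<close> by \<open>l\<close>
  matrix \<open>B * A\<close>. So they fit into \<open>l\<close> places, and the rest is filled with
  zeros.\<close>

lemma nonzero_eigenvalue_list_exists:
  assumes A: "A \<in> carrier_mat k l" and B: "B \<in> carrier_mat l k"
  shows "\<exists>a. nonzero_eigenvalue_list l a (A * B)"
proof -
  let ?c = "map_mat complex_of_real"
  define R where "R = filter_mset (\<lambda>z. z \<noteq> 0) (proots (char_poly (?c (A * B))))"
  have AB: "?c (A * B) = ?c A * ?c B"
    using of_real_hom.mat_hom_mult[OF A B] .
  have "size R \<le> size (proots (char_poly (?c B * ?c A)))"
    using A B unfolding R_def AB
    by (subst char_poly_mult_swap_roots[of _ k l]) (auto intro: size_filter_mset_lesseq)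
  also have "\<dots> = l"
    using degree_monic_char_poly[of "?c B * ?c A" l] A B by (simp add: size_proots_complex)
  finally have size: "size R \<le> l" .
  obtain rs where rs: "mset rs = R" using ex_mset by blast
  define zs where "zs = rs @ replicate (l - length rs) 0"
  have len: "length zs = l" using size rs by (auto simp: zs_def)
  \<comment> \<open>The values \<alpha> are numbered from 1, list positions from 0.\<close>
  define a where "a j = zs ! (j - 1)" for j
  have "image_mset a (mset_set {1..l}) = mset (map a [1..<Suc l])"
    by (simp add: atLeastLessThanSuc_atLeastAtMost del: upt_Suc)
  also have "map a [1..<Suc l] = zs"
    using len by (intro nth_equalityI) (auto simp: a_def simp del: upt_Suc)
  finally have "filter_mset (\<lambda>z. z \<noteq> 0) (image_mset a (mset_set {1..l})) = R"
    by (simp add: zs_def rs) (simp add: R_def filter_filter_mset)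
  then show ?thesis unfolding nonzero_eigenvalue_list_def R_def by blast
qed

text \<open>Meant for \<open>f z = 1 + d * z\<close>: zero values contribute the factor 1, so a list
  of length \<open>l\<close> can be compared with the \<open>k\<close> roots of a characteristic
  polynomial.\<close>

lemma prod_mset_filter_nonzero:
  fixes f :: "'a :: zero \<Rightarrow> 'b :: comm_monoid_mult"
  assumes "f 0 = 1"
  shows "(\<Prod>z \<in># filter_mset (\<lambda>z. z \<noteq> 0) S. f z) = (\<Prod>z \<in># S. f z)"
  using assms by (induction S) auto

text \<open>From \<open>1 + d z = -d (-1/d - z)\<close> the product over the \<open>k\<close> roots
  of the characteristic polynomial \<open>p\<close> equals \<open>(-d)^k p(-1/d)\<close>, and the
  power of the scalar moves into the determinant of size \<open>k\<close>.\<close>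

lemma nonzero_eigenvalue_list_prod:
  assumes M: "M \<in> carrier_mat k k" and a: "nonzero_eigenvalue_list l a M" and d: "d \<noteq> 0"
  shows "(\<Prod>j = 1..l. 1 + complex_of_real d * a j) = complex_of_real (det (1\<^sub>m k + d \<cdot>\<^sub>m M))"
proof -
  let ?M = "map_mat complex_of_real M" and ?d = "complex_of_real d"
  have Mc: "?M \<in> carrier_mat k k" using M by simp
  let ?p = "char_poly ?M"
  have p: "degree ?p = k" "lead_coeff ?p = 1"
    using degree_monic_char_poly[OF Mc] by auto
  have "(\<Prod>j = 1..l. 1 + ?d * a j) = (\<Prod>z \<in># image_mset a (mset_set {1..l}). 1 + ?d * z)"
    by (simp add: prod_unfold_prod_mset image_mset.compositionality o_def)
  also have "\<dots> = (\<Prod>z \<in># filter_mset (\<lambda>z. z \<noteq> 0) (image_mset a (mset_set {1..l})). 1 + ?d * z)"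
    by (rule prod_mset_filter_nonzero[symmetric]) simp
  also have "\<dots> = (\<Prod>z \<in># filter_mset (\<lambda>z. z \<noteq> 0) (proots ?p). 1 + ?d * z)"
    using a by (simp only: nonzero_eigenvalue_list_def)
  also have "\<dots> = (\<Prod>z \<in># proots ?p. 1 + ?d * z)"
    by (rule prod_mset_filter_nonzero) simp
  also have "\<dots> = (\<Prod>z \<in># proots ?p. - ?d * (- 1 / ?d - z))"
    using d by (intro arg_cong[where f = prod_mset] image_mset_cong) (simp add: field_simps)
  also have "\<dots> = (- ?d) ^ k * (\<Prod>z \<in># proots ?p. - 1 / ?d - z)"
    by (subst prod_mset.distrib) (simp add: size_proots_complex p prod_mset_constant)
  also have "(\<Prod>z \<in># proots ?p. - 1 / ?d - z) = poly (\<Prod>z \<in># proots ?p. [:- z, 1:]) (- 1 / ?d)"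
    by (auto simp: poly_prod_mset image_mset.compositionality o_def
        intro!: arg_cong[where f = prod_mset] image_mset_cong)
  also have "(\<Prod>z \<in># proots ?p. [:- z, 1:]) = ?p"
    using complex_poly_decompose_multiset[of ?p] p by simp
  also have "(- ?d) ^ k * poly ?p (- 1 / ?d) = det ((- ?d) \<cdot>\<^sub>m ((- 1 / ?d) \<cdot>\<^sub>m 1\<^sub>m k - ?M))"
    using Mc by (simp add: poly_char_poly[OF Mc])
  also have "(- ?d) \<cdot>\<^sub>m ((- 1 / ?d) \<cdot>\<^sub>m 1\<^sub>m k - ?M) = map_mat complex_of_real (1\<^sub>m k + d \<cdot>\<^sub>m M)"
    using M d by (intro eq_matI) (auto simp: field_simps)
  also have "det \<dots> = complex_of_real (det (1\<^sub>m k + d \<cdot>\<^sub>m M))"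
    by (rule of_real_hom.hom_det)
  finally show ?thesis .
qed

section \<open>The determinant under a rank-one change\<close>

text \<open>\<open>X\<close> is only a one-sided inverse, hence two cases. For a right inverse,
  \<open>v^T X = y^T M X\<close> lets \<open>M X\<close> split off on the right; for a left inverse,
  \<open>X u = X M x\<close> lets \<open>X M\<close> split off on the left. What remains is the
  identity plus a rank-one matrix.\<close>

lemma det_one_add_update:
  fixes M D X :: "'a :: idom mat"
  assumes D: "D \<in> carrier_mat k l" and X: "X \<in> carrier_mat l k"
    and M0: "M0 \<in> carrier_mat k l" and M: "M = M0 + d \<cdot>\<^sub>m D"
    and x: "x \<in> carrier_vec l" and y: "y \<in> carrier_vec k"
    and u: "M *\<^sub>v x = u" and v: "transpose_mat M *\<^sub>v y = v"
    and inv: "M0 * X = 1\<^sub>m k \<or> X * M0 = 1\<^sub>m l"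
  shows "det (1\<^sub>m k + d \<cdot>\<^sub>m ((D + transpose_mat (mat_of_row u) * mat_of_row v) * X)) =
         det (1\<^sub>m k + d \<cdot>\<^sub>m (D * X)) * (1 + d * (v \<bullet> x))"
proof -
  have Mc: "M \<in> carrier_mat k l" using M M0 D by auto
  have uc: "u \<in> carrier_vec k" and vc: "v \<in> carrier_vec l"
    using mult_mat_vec_carrier[OF Mc x] mult_mat_vec_carrier[of "transpose_mat M" l k y] u v Mc y by auto
  define U where "U = transpose_mat (mat_of_row u)"
  define V where "V = mat_of_row v"
  define xc where "xc = transpose_mat (mat_of_row x)"
  define yr where "yr = mat_of_row y"
  have carr: "U \<in> carrier_mat k 1" "V \<in> carrier_mat 1 l" "xc \<in> carrier_mat l 1" "yr \<in> carrier_mat 1 k"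
    using uc vc x y by (auto simp: U_def V_def xc_def yr_def)
  have U: "U = M * xc"
    using Mc x by (intro eq_matI) (auto simp: U_def xc_def simp flip: u intro!: arg_cong2[of _ _ _ _ scalar_prod])
  have V: "V = yr * M"
    using Mc y by (intro eq_matI) (auto simp: V_def yr_def comm_scalar_prod[of _ k] simp flip: v)
  \<comment> \<open>Both sides are \<open>y^T M x\<close>. This equality of dual and primal value
    makes the two cases end in the same scalar.\<close>
  have yu: "y \<bullet> u = v \<bullet> x"
    using transpose_vec_mult_scalar[OF Mc x y] u v Mc x y vc
    by simp
  \<comment> \<open>The factor \<open>d\<close> is absorbed into the left vector to reach the form
    of the matrix determinant lemma.\<close>
  have smult_row: "d \<cdot>\<^sub>m (transpose_mat (mat_of_row w) * mat_of_row z)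
      = transpose_mat (mat_of_row (d \<cdot>\<^sub>v w)) * mat_of_row z" for w z :: "'a vec"
    by (intro eq_matI) (auto simp: scalar_prod_def)
  from inv show ?thesis
  proof
    assume id: "M0 * X = 1\<^sub>m k"
    have MX: "M * X = 1\<^sub>m k + d \<cdot>\<^sub>m (D * X)"
      using M0 D X by (simp add: M add_mult_distrib_mat[of _ k l _ _ k] smult_mult_dim id)
    have "1\<^sub>m k + d \<cdot>\<^sub>m ((D + U * V) * X) = (1\<^sub>m k + d \<cdot>\<^sub>m (D * X)) + d \<cdot>\<^sub>m (U * yr) * (M * X)"
      using carr D X Mc
      by (simp add: add_mult_distrib_mat[of _ k l _ _ k] V mult_assoc_dim smult_mult_dim mult_smult_dim
          add_smult_distrib_left_mat[of _ k k] assoc_add_mat[of _ k k])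
    also have "\<dots> = (1\<^sub>m k + d \<cdot>\<^sub>m (U * yr)) * (M * X)"
      using carr X Mc by (simp add: MX[symmetric] add_mult_distrib_mat[of _ k k _ _ k] smult_mult_dim)
    finally have "det (1\<^sub>m k + d \<cdot>\<^sub>m ((D + U * V) * X)) = det (1\<^sub>m k + d \<cdot>\<^sub>m (U * yr)) * det (M * X)"
      using carr X Mc by (simp add: det_mult[of _ k])
    also have "det (1\<^sub>m k + d \<cdot>\<^sub>m (U * yr)) = 1 + d * (v \<bullet> x)"
      using uc y by (simp add: U_def yr_def smult_row det_one_add_rank_one[of _ k]
          comm_scalar_prod[of u k y] flip: yu)
    finally show ?thesis by (simp add: MX U_def V_def mult.commute)
  next
    assume id: "X * M0 = 1\<^sub>m l"
    have XM: "X * M = 1\<^sub>m l + d \<cdot>\<^sub>m (X * D)"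
      using M0 D X by (simp add: M mult_add_distrib_mat[of _ l k _ l] mult_smult_dim id)
    \<comment> \<open>The identity \<open>X * M0\<close> has size \<open>l\<close>, so both
      determinants are moved to that size first.\<close>
    have swap: "det (1\<^sub>m k + d \<cdot>\<^sub>m (E * X)) = det (1\<^sub>m l + X * (d \<cdot>\<^sub>m E))"
      if E: "E \<in> carrier_mat k l" for E
      using det_one_add_mult_swap[of "d \<cdot>\<^sub>m E" k l X] E X by (simp add: smult_mult_dim mult_smult_dim)
    have "1\<^sub>m l + X * (d \<cdot>\<^sub>m (D + U * V)) = (1\<^sub>m l + d \<cdot>\<^sub>m (X * D)) + X * M * (d \<cdot>\<^sub>m (xc * V))"
      using carr D X Mc
      by (simp add: mult_add_distrib_mat[of _ l k _ l] U mult_assoc_dim smult_mult_dim mult_smult_dim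
          add_smult_distrib_left_mat[of _ k l] assoc_add_mat[of _ l l])
    also have "\<dots> = X * M * (1\<^sub>m l + d \<cdot>\<^sub>m (xc * V))"
      using carr X Mc by (simp add: XM[symmetric] mult_add_distrib_mat[of _ l l _ l] mult_smult_dim)
    finally have "det (1\<^sub>m l + X * (d \<cdot>\<^sub>m (D + U * V))) = det (X * M) * det (1\<^sub>m l + d \<cdot>\<^sub>m (xc * V))"
      using carr X Mc by (simp add: det_mult[of _ l])
    also have "det (1\<^sub>m l + d \<cdot>\<^sub>m (xc * V)) = 1 + d * (v \<bullet> x)"
      using vc x by (simp add: xc_def V_def smult_row det_one_add_rank_one[of _ l]
          comm_scalar_prod[of x l v])
    finally show ?thesis
      using carr D X by (simp add: XM swap mult_smult_dim flip: U_def V_def)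
  qed
qed

subsection \<open>Selecting columns and components\<close>

text \<open>\<open>pick J\<close> is strictly increasing, hence injective, and its
  \<open>card J\<close> values fill \<open>J\<close> by counting.\<close>

lemma bij_betw_pick:
  assumes "finite J"
  shows "bij_betw (pick J) {..<card J} J"
proof -
  have "inj_on (pick J) {..<card J}"
    by (rule linorder_inj_onI') (metis lessThan_iff less_irrefl pick_mono_le)
  moreover from this have "pick J ` {..<card J} = J"
    using assms by (intro card_subset_eq) (auto simp: card_image pick_in_set_le)
  ultimately show ?thesis by (simp add: bij_betw_def)
qed

lemma sel_vec_carrier:
  assumes "J \<subseteq> {..<dim_vec v}"
  shows "sel_vec v J \<in> carrier_vec (card J)"
    and "q < card J \<Longrightarrow> sel_vec v J $ q = v $ pick J q"
proof -
  have "{j. j < dim_vec v \<and> j \<in> J} = J" using assms by auto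
  then show "sel_vec v J \<in> carrier_vec (card J)" "q < card J \<Longrightarrow> sel_vec v J $ q = v $ pick J q"
    by (simp_all add: sel_vec_def)
qed

lemma sel_cols_carrier:
  assumes M: "M \<in> carrier_mat k N" and J: "J \<subseteq> {..<N}"
  shows "sel_cols M J \<in> carrier_mat k (card J)"
    and "i < k \<Longrightarrow> q < card J \<Longrightarrow> sel_cols M J $$ (i, q) = M $$ (i, pick J q)"
proof -
  have "{j. j < N \<and> j \<in> J} = J" using J by auto
  then show "sel_cols M J \<in> carrier_mat k (card J)"
    "i < k \<Longrightarrow> q < card J \<Longrightarrow> sel_cols M J $$ (i, q) = M $$ (i, pick J q)"
    using M by (simp_all add: sel_cols_def submatrix_def pick_UNIV)
qed

text \<open>Reindexing along \<open>pick\<close> gives the sum over \<open>J\<close>; outside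
  \<open>J\<close> the terms vanish with \<open>x\<close>.\<close>

lemma scalar_prod_sel_vec:
  assumes v: "v \<in> carrier_vec N" and x: "x \<in> carrier_vec N" and J: "J \<subseteq> {..<N}"
    and zero: "\<And>j. j < N \<Longrightarrow> j \<notin> J \<Longrightarrow> x $ j = 0"
  shows "sel_vec v J \<bullet> sel_vec x J = v \<bullet> x"
proof -
  have fin: "finite J" using J finite_subset by blast
  have "sel_vec v J \<bullet> sel_vec x J = (\<Sum>q<card J. v $ pick J q * x $ pick J q)"
    using v x J sel_vec_carrier[of J v] sel_vec_carrier[of J x]
    by (simp add: scalar_prod_def atLeast0LessThan)
  also have "\<dots> = (\<Sum>j\<in>J. v $ j * x $ j)"
    by (rule sum.reindex_bij_betw[OF bij_betw_pick[OF fin]])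
  also have "\<dots> = (\<Sum>j<N. v $ j * x $ j)"
    using J zero by (intro sum.mono_neutral_left) auto
  finally show ?thesis
    using x by (simp add: scalar_prod_def atLeast0LessThan)
qed

lemma sel_cols_mult_sel_vec:
  assumes M: "M \<in> carrier_mat k N" and x: "x \<in> carrier_vec N" and J: "J \<subseteq> {..<N}"
    and zero: "\<And>j. j < N \<Longrightarrow> j \<notin> J \<Longrightarrow> x $ j = 0"
  shows "sel_cols M J *\<^sub>v sel_vec x J = M *\<^sub>v x"
proof (rule eq_vecI)
  note carr = sel_cols_carrier[OF M J]
  fix i assume "i < dim_vec (M *\<^sub>v x)"
  then have i: "i < k" using M by simp
  have "row (sel_cols M J) i = sel_vec (row M i) J"
    using M J i carr sel_vec_carrier[of J "row M i"] by (intro eq_vecI) (auto dest: pick_in_set_le)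
  then show "(sel_cols M J *\<^sub>v sel_vec x J) $ i = (M *\<^sub>v x) $ i"
    using scalar_prod_sel_vec[of "row M i" N x J] M x J zero i carr by simp
qed (use M sel_cols_carrier[OF M J] in auto)

text \<open>Deleting columns of \<open>M\<close> deletes rows of its transpose, so here, unlike for
  \<open>M *\<^sub>v x\<close>, the vector carries no support condition.\<close>

lemma transpose_sel_cols_mult_vec:
  assumes M: "M \<in> carrier_mat k N" and J: "J \<subseteq> {..<N}"
  shows "transpose_mat (sel_cols M J) *\<^sub>v y = sel_vec (transpose_mat M *\<^sub>v y) J"
proof (rule eq_vecI)
  note carr = sel_cols_carrier[OF M J]
  have dim: "J \<subseteq> {..<dim_vec (transpose_mat M *\<^sub>v y)}" using M J by simp
  note sv = sel_vec_carrier[OF dim]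
  show "dim_vec (transpose_mat (sel_cols M J) *\<^sub>v y) = dim_vec (sel_vec (transpose_mat M *\<^sub>v y) J)"
    using carr sv by simp
  fix q assume "q < dim_vec (sel_vec (transpose_mat M *\<^sub>v y) J)"
  then have q: "q < card J" using sv by simp
  then have pick: "pick J q < N" using pick_in_set_le[of q J] J by auto
  have "col (sel_cols M J) q = col M (pick J q)"
    using M carr q pick by (intro eq_vecI) auto
  then show "(transpose_mat (sel_cols M J) *\<^sub>v y) $ q = sel_vec (transpose_mat M *\<^sub>v y) J $ q"
    using M carr sv q pick by simp
qed

subsection \<open>The block formulation\<close>

lemma pert_blk:
  assumes "A \<in> carrier_mat m n" and "dA \<in> carrier_mat m n"
  shows "pert (blkA A dA) (blk_dA A) t = four_block_mat A (t \<cdot>\<^sub>m 1\<^sub>m m) dA (- 1\<^sub>m m)"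
  using assms by (intro eq_matI) (auto simp: pert_def blkA_def blk_dA_def)

text \<open>The two blocks are the left-hand sides of the two dual equations, the first one without
  its slack. This ties the dual, which is defined blockwise, to the transposed block matrix.\<close>

lemma transpose_pert_blk_mult:
  assumes A: "A \<in> carrier_mat m n" and dA: "dA \<in> carrier_mat m n"
    and y: "y \<in> carrier_vec m" and w: "w \<in> carrier_vec m"
  shows "transpose_mat (pert (blkA A dA) (blk_dA A) t) *\<^sub>v (y @\<^sub>v w) =
         (transpose_mat A *\<^sub>v y + transpose_mat dA *\<^sub>v w) @\<^sub>v (t \<cdot>\<^sub>v y - w)"
proof -
  have "transpose_mat (pert (blkA A dA) (blk_dA A) t) =
      four_block_mat (transpose_mat A) (transpose_mat dA) (t \<cdot>\<^sub>m 1\<^sub>m m) (- 1\<^sub>m m)"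
    using A dA unfolding pert_blk[OF A dA] by (intro eq_matI) auto
  moreover have "t \<cdot>\<^sub>m 1\<^sub>m m *\<^sub>v y + - 1\<^sub>m m *\<^sub>v w = t \<cdot>\<^sub>v y - w"
    using y w by (intro eq_vecI) auto
  ultimately show ?thesis
    using A dA y w by (simp add: four_block_mat_mult_vec[of _ n m _ m _ m])
qed

lemma Z_eq_optimal:
  assumes "x \<in> P'_optimal A dA b db c t"
  shows "Z A dA b db c t = blk_c A c \<bullet> x"
  unfolding Z_def using assms
  by (intro cInf_eq_minimum) (auto simp: P'_optimal_def is_arg_min_linorder)

section \<open>The representation of the optimal value\<close>

theorem theorem5:
  fixes A dA :: "real mat" and b db c :: "real vec" and m n l :: nat and t0 t :: real
    and J K :: "nat set" and x y s :: "real vec"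
  assumes A: "A \<in> carrier_mat m n" and dA: "dA \<in> carrier_mat m n"
    and b: "b \<in> carrier_vec m" and db: "db \<in> carrier_vec m" and c: "c \<in> carrier_vec n"
    and feas_P: "P_feasible A dA b db 0 \<noteq> {}" and feas_D: "D_feasible A dA c 0 \<noteq> {}"
    and interval: "\<forall>u \<in> Lam A dA b db c. \<forall>v \<in> Lam A dA b db c. {u..v} \<subseteq> Lam A dA b db c"
    and t0: "t0 \<in> Lam A dA b db c"
    and partition: "induced_partition A dA b db c t0 = (J, K)" and l: "l = card J"
    and full_rank: "2 * m \<le> l \<Longrightarrow> A_bar A dA J t0 * pinv (A_bar A dA J t0) = 1\<^sub>m (2 * m)"
                   "2 * m \<ge> l \<Longrightarrow> pinv (A_bar A dA J t0) * A_bar A dA J t0 = 1\<^sub>m l"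
    and t: "t \<in> Lam A dA b db c" "t \<noteq> t0"
    and induced: "induced_optimal A dA b db c t x y s"
    and cond1: "condition1 A dA J t"
    and cond2: "condition2 A dA b db c t0 J t x"
    and cond3: "condition3 A dA b db c t0 t s"
  defines "dA\<tau> \<equiv> sel_cols (blk_dA A) J" and "A\<tau>_inv \<equiv> pinv (A_bar A dA J t0)"
    and "bc\<tau> \<equiv> transpose_mat (mat_of_row (blk_b b db)) * mat_of_row (sel_vec (blk_c A c) J)"
  shows
    "(\<exists>\<alpha>. nonzero_eigenvalue_list l \<alpha> (dA\<tau> * A\<tau>_inv)) \<and>
     (\<exists>\<alpha>x. nonzero_eigenvalue_list l \<alpha>x ((dA\<tau> + bc\<tau>) * A\<tau>_inv)) \<and>
     (\<forall>\<alpha> \<alpha>x.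
        nonzero_eigenvalue_list l \<alpha> (dA\<tau> * A\<tau>_inv) \<longrightarrow>
        nonzero_eigenvalue_list l \<alpha>x ((dA\<tau> + bc\<tau>) * A\<tau>_inv) \<longrightarrow>
        (\<forall>j \<in> {1..l}. 1 + complex_of_real (t - t0) * \<alpha> j \<noteq> 0) \<longrightarrow>
        complex_of_real (Z A dA b db c t) =
          1 / complex_of_real (t - t0) *
          ((\<Prod>j = 1..l. (1 + complex_of_real (t - t0) * \<alpha>x j) / (1 + complex_of_real (t - t0) * \<alpha> j)) - 1))"
proof -
  define M0 where "M0 = A_bar A dA J t0"
  define M where "M = A_bar A dA J t"
  define d where "d = t - t0"
  define u where "u = blk_b b db"
  define v where "v = sel_vec (blk_c A c) J"
  define N where "N r = pert (blkA A dA) (blk_dA A) r" for r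
  have J: "J = part_B A dA b db c t0 \<union> part_Bminus A dA b db c t0 \<union> part_Bplus A dA b db c t0"
    using partition by (simp add: induced_partition_def)
  have J_sub: "J \<subseteq> {..<n + m}"
    using A by (auto simp: J part_B_def part_Bminus_def part_Bplus_def)
  have N: "N r \<in> carrier_mat (2 * m) (n + m)" for r
    using A dA unfolding N_def pert_blk[OF A dA] by (auto simp: mult_2)
  have dAc: "blk_dA A \<in> carrier_mat (2 * m) (n + m)"
    using A by (auto simp: blk_dA_def mult_2)
  note sel = sel_cols_carrier[OF _ J_sub, folded l]
  have M0c: "M0 \<in> carrier_mat (2 * m) l" and Mc: "M \<in> carrier_mat (2 * m) l"
    and Dc: "dA\<tau> \<in> carrier_mat (2 * m) l"
    using sel(1)[OF N] sel(1)[OF dAc] by (auto simp: M0_def M_def dA\<tau>_def A_bar_def N_def)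
  have Xc: "A\<tau>_inv \<in> carrier_mat l (2 * m)"
    using M0c by (simp add: A\<tau>_inv_def M0_def)
  have bc: "bc\<tau> = transpose_mat (mat_of_row u) * mat_of_row v"
    by (simp add: bc\<tau>_def u_def v_def)
  have cc: "blk_c A c \<in> carrier_vec (n + m)"
    using A c by (auto simp: blk_c_def)
  have vc: "v \<in> carrier_vec l" and uc: "u \<in> carrier_vec (2 * m)"
    using sel_vec_carrier(1)[of J "blk_c A c"] J_sub cc b db
    by (auto simp: v_def l u_def blk_b_def mult_2)

  \<comment> \<open>Selecting columns is linear, and \<open>t = t0 + d\<close>.\<close>
  have M_eq: "M = M0 + d \<cdot>\<^sub>m dA\<tau>"
  proof (rule eq_matI)
    fix i q assume "i < dim_row (M0 + d \<cdot>\<^sub>m dA\<tau>)" "q < dim_col (M0 + d \<cdot>\<^sub>m dA\<tau>)"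
    then have i: "i < 2 * m" and q: "q < l" using M0c Dc by auto
    have p: "pick J q < n + m" using pick_in_set_le[of q J] J_sub q l by auto
    have ent: "sel_cols (N r) J $$ (i, q) = blkA A dA $$ (i, pick J q) + r * blk_dA A $$ (i, pick J q)" for r
      using sel(2)[OF N i q] dAc i p by (simp add: N_def pert_def)
    show "M $$ (i, q) = (M0 + d \<cdot>\<^sub>m dA\<tau>) $$ (i, q)"
      using ent[of t] ent[of t0] sel(2)[OF dAc i q] M0c Dc i q
      by (simp add: M_def M0_def A_bar_def N_def dA\<tau>_def d_def algebra_simps)
  qed (use Mc M0c Dc in auto)

  \<comment> \<open>Primal side: feasibility and value on the basic columns\<close>
  have x_opt: "x \<in> P'_optimal A dA b db c t" and y_opt: "(y, s) \<in> D'_optimal A dA b db c t"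
    using induced by (auto simp: induced_optimal_def)
  from x_opt have x_feas: "x \<in> P'_feasible A dA b db t"
    by (simp add: P'_optimal_def is_arg_min_def)
  then have xc: "x \<in> carrier_vec (n + m)" and Nx: "N t *\<^sub>v x = u"
    using A by (auto simp: P'_feasible_def N_def u_def)
  \<comment> \<open>Condition 2 confines the support of \<open>x\<close> to \<open>J\<close>, so
    restricting to \<open>J\<close> changes neither the product with the matrix nor the
    cost.\<close>
  have x_zero: "x $ j = 0" if "j < n + m" "j \<notin> J" for j
    using cond2 that A by (simp add: condition2_def)
  have Mx: "M *\<^sub>v sel_vec x J = u"
    using sel_cols_mult_sel_vec[OF N xc J_sub x_zero] Nx by (simp add: M_def A_bar_def N_def)
  have Z: "Z A dA b db c t = v \<bullet> sel_vec x J"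
    using scalar_prod_sel_vec[OF cc xc J_sub x_zero] Z_eq_optimal[OF x_opt] by (simp add: v_def)
  have xJ: "sel_vec x J \<in> carrier_vec l"
    using sel_vec_carrier(1)[of J x] J_sub xc l by simp

  \<comment> \<open>Dual side: the constraints on the basic columns\<close>
  from y_opt have "(y, s) \<in> D'_feasible A dA c t"
    by (simp add: D'_optimal_def is_arg_max_def)
  then obtain y1 w s1 where ys: "y = y1 @\<^sub>v w" "s = s1 @\<^sub>v 0\<^sub>v m"
    and y1: "y1 \<in> carrier_vec m" and w: "w \<in> carrier_vec m" and s1: "s1 \<in> carrier_vec n"
    and dual: "transpose_mat A *\<^sub>v y1 + transpose_mat dA *\<^sub>v w + s1 = c"
    and tw: "t \<cdot>\<^sub>v y1 - w = 0\<^sub>v m"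
    using A by (auto simp: D'_feasible_def)
  have yc: "y \<in> carrier_vec (2 * m)" using ys y1 w by (auto simp: mult_2)
  have Nty: "transpose_mat (N t) *\<^sub>v y = (transpose_mat A *\<^sub>v y1 + transpose_mat dA *\<^sub>v w) @\<^sub>v 0\<^sub>v m"
    using transpose_pert_blk_mult[OF A dA y1 w, of t] by (simp add: N_def ys tw)
  \<comment> \<open>Complementary slackness: by condition 3 the dual slack vanishes on \<open>J\<close>, so the
      dual constraints with index in \<open>J\<close> are equations.\<close>
  have tight: "(transpose_mat (N t) *\<^sub>v y) $ j = blk_c A c $ j" if j: "j \<in> J" for j
  proof (cases "j < n")
    case True
    \<comment> \<open>The other two classes making up \<open>J\<close> contain only indices from
      \<open>n\<close> on.\<close>
    then have "j \<in> part_B A dA b db c t0"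
      using j A by (auto simp: J part_Bminus_def part_Bplus_def)
    then have "s $ j = 0"
      using cond3 True A by (simp add: condition3_def Let_def)
    then have "s1 $ j = 0"
      using True s1 by (simp add: ys)
    moreover have "(transpose_mat A *\<^sub>v y1 + transpose_mat dA *\<^sub>v w + s1) $ j = c $ j"
      using dual by simp
    ultimately show ?thesis
      using True A dA s1 y1 w c by (simp add: Nty blk_c_def)
  next
    case False
    \<comment> \<open>For an index of the free part \<open>z\<close> both sides are zero: the left
      by \<open>tw\<close>, the right because \<open>z\<close> has zero cost.\<close>
    then show ?thesis using A dA c J_sub j by (auto simp: Nty blk_c_def)
  qed
  have My: "transpose_mat M *\<^sub>v y = v"
  proof -
    have dim: "dim_vec (transpose_mat (N t) *\<^sub>v y) = n + m"
      using N[of t] by simp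
    have "sel_vec (transpose_mat (N t) *\<^sub>v y) J = sel_vec (blk_c A c) J"
      using tight cc dim J_sub sel_vec_carrier[of J "transpose_mat (N t) *\<^sub>v y"]
        sel_vec_carrier[of J "blk_c A c"]
      by (intro eq_vecI) (auto simp: pick_in_set_le)
    then show ?thesis
      using transpose_sel_cols_mult_vec[OF N J_sub, of t y] by (simp add: M_def A_bar_def N_def v_def)
  qed

  \<comment> \<open>From determinants to eigenvalues\<close>
  \<comment> \<open>Full rank gives a right inverse for a wide matrix and a left inverse for a tall
    one.\<close>
  have inv: "M0 * A\<tau>_inv = 1\<^sub>m (2 * m) \<or> A\<tau>_inv * M0 = 1\<^sub>m l"
    using full_rank by (cases "2 * m \<le> l") (auto simp: M0_def A\<tau>_inv_def)
  define \<Delta> where "\<Delta> = det (1\<^sub>m (2 * m) + d \<cdot>\<^sub>m (dA\<tau> * A\<tau>_inv))"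
  have det: "det (1\<^sub>m (2 * m) + d \<cdot>\<^sub>m ((dA\<tau> + bc\<tau>) * A\<tau>_inv)) = \<Delta> * (1 + d * Z A dA b db c t)"
    using det_one_add_update[OF Dc Xc M0c M_eq xJ yc Mx My inv] by (simp add: bc Z \<Delta>_def)
  have d0: "d \<noteq> 0" using t by (simp add: d_def)
  have bcc: "dA\<tau> + bc\<tau> \<in> carrier_mat (2 * m) l"
    using Dc uc vc by (auto simp: bc)
  show ?thesis
  proof (intro conjI allI impI)
    fix \<alpha> \<alpha>x
    assume a: "nonzero_eigenvalue_list l \<alpha> (dA\<tau> * A\<tau>_inv)"
      and ax: "nonzero_eigenvalue_list l \<alpha>x ((dA\<tau> + bc\<tau>) * A\<tau>_inv)"
      and nz: "\<forall>j \<in> {1..l}. 1 + complex_of_real (t - t0) * \<alpha> j \<noteq> 0"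
    have prod: "(\<Prod>j = 1..l. 1 + complex_of_real d * \<alpha> j) = complex_of_real \<Delta>"
      unfolding \<Delta>_def using Dc Xc by (intro nonzero_eigenvalue_list_prod[OF _ a d0]) auto
    have "(\<Prod>j = 1..l. 1 + complex_of_real d * \<alpha>x j) =
        complex_of_real (\<Delta> * (1 + d * Z A dA b db c t))"
      unfolding det[symmetric] using bcc Xc by (intro nonzero_eigenvalue_list_prod[OF _ ax d0]) auto
    \<comment> \<open>\<Delta> is the product of the denominators, each assumed nonzero, so it
      cancels in the quotient and leaves \<open>1 + d * Z\<close>.\<close>
    moreover have "complex_of_real \<Delta> \<noteq> 0"
      using nz unfolding prod[symmetric] d_def by simp
    ultimately have "(\<Prod>j = 1..l. (1 + complex_of_real d * \<alpha>x j) / (1 + complex_of_real d * \<alpha> j)) =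
        1 + complex_of_real d * complex_of_real (Z A dA b db c t)"
      by (simp only: prod_dividef prod) simp
    then show "complex_of_real (Z A dA b db c t) =
          1 / complex_of_real (t - t0) *
          ((\<Prod>j = 1..l. (1 + complex_of_real (t - t0) * \<alpha>x j) / (1 + complex_of_real (t - t0) * \<alpha> j)) - 1)"
      using d0 by (simp add: d_def)
  qed (use nonzero_eigenvalue_list_exists[OF Dc Xc] nonzero_eigenvalue_list_exists[OF bcc Xc] in auto)
qed

end
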